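(* Let $G=(V,E)$ be a dismantable graph with a natural dismantling order $<$ and an associated domination map $\delta$. Assume that the map $\rho_\nu$ (defined from $<$ and $\delta$) is defined for every $\nu\in V$ and that for each pair $\nu,\mu$ of vertices there is some $\gamma$ such that $\rho_\gamma(\nu)=\rho_\gamma(\mu)$. Then $G$ is weakly cop-win.
   Context: Graphs are undirected and reflexive (there is a loop at every vertex). A vertex $\mu\neq\nu$ dominates $\nu$ in a graph if $\mu$ is adjacent to $\nu$ and to all neighbours of $\nu$. Dismantable: for a well order $<$ on $V$, $G_{\ge\nu}$ denotes the subgraph of $G$ induced by all vertices $\ge\nu$. $G$ is dismantable if there is a well order $<$ on $V$ (a dismantling order) such that every vertex $\nu$, except the largest one if there is a largest one, is dominated by some vertex of $G_{\ge\nu}$ in $G_{\ge\nu}$. An associated domination map $\delta$ maps each such $\nu$ to a vertex that dominates $\nu$ in $G_{\ge\nu}$. An order is natural if it is order isomorphic to an ordinal $\alpha\le\mathbb N$ (i.e. to a finite ordinal or to $\mathbb N$); one identifies $V$ with this ordinal. For $\nu\in V$ define $\rho_\nu\colon G\to G_{\ge\nu}$ by $\rho_\nu(\mu)=\delta^{k(\nu,\mu)}(\mu)$, where $k(\nu,\mu)=\min\{k\in\mathbb N\mid\delta^k(\mu)\ge\nu\}$. The map $\rho_\nu$ is said to be defined if this minimum exists for all $\mu\in V$. The game: two players, the cop and the robber, have perfect information and move in rounds $0,1,2,\dots$; the cop plays in even rounds, the robber in odd rounds. In round $0$ the cop chooses a starting vertex, in round $1$ the robber chooses a starting vertex; in each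 later round the player whose turn it is moves to a neighbour of their current vertex (because of the loops, staying put is allowed). The robber is caught (and the game ends) as soon as both players occupy the same vertex. A strategy of the cop is a choice of starting vertex together with a function $S\colon V\times V\to V$ assigning to $(c,r)$ a neighbour of $c$: when it is the cop's turn, the cop is at $c$ and the robber is at $r$, she moves to $S(c,r)$. A strategy of the cop is weakly winning if it prevents the robber from visiting any vertex infinitely often, i.e. in every play in which the cop follows the strategy, either the robber is caught after finitely many rounds or every vertex is occupied by the robber in only finitely many rounds. A graph is weakly cop-win if the cop has a weakly winning strategy on it. *)

theory Defs
  imports Main
begin

unbundle cardinal_syntax

(* Non-emptiness is part of the notion of graph: without a vertex the cop has no starting
   vertex to choose. *)
definition refl_graph :: "'a set \<Rightarrow> 'a rel \<Rightarrow> bool" where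
  "refl_graph V E \<longleftrightarrow> V \<noteq> {} \<and> E \<subseteq> V \<times> V \<and> refl_on V E \<and> sym E"

definition dominates :: "'a set \<Rightarrow> 'a rel \<Rightarrow> 'a \<Rightarrow> 'a \<Rightarrow> bool" where
  "dominates V E \<mu> \<nu> \<longleftrightarrow>
     \<mu> \<in> V \<and> \<nu> \<in> V \<and> \<mu> \<noteq> \<nu> \<and> (\<mu>, \<nu>) \<in> E \<and> (\<forall>x. (\<nu>, x) \<in> E \<longrightarrow> (\<mu>, x) \<in> E)"

(* Well orders are given by their reflexive relation r; above r \<nu> is the set of all vertices
   that are at least \<nu>, so the graph in the next definition is the subgraph induced by it. *)
definition dominates_above :: "'a rel \<Rightarrow> 'a rel \<Rightarrow> 'a \<Rightarrow> 'a \<Rightarrow> bool" where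
  "dominates_above E r \<mu> \<nu> \<longleftrightarrow> dominates (above r \<nu>) (Restr E (above r \<nu>)) \<mu> \<nu>"

definition largest :: "'a set \<Rightarrow> 'a rel \<Rightarrow> 'a \<Rightarrow> bool" where
  "largest V r \<nu> \<longleftrightarrow> \<nu> \<in> V \<and> (\<forall>\<mu>\<in>V. (\<mu>, \<nu>) \<in> r)"

definition dismantling_order :: "'a set \<Rightarrow> 'a rel \<Rightarrow> 'a rel \<Rightarrow> bool" where
  "dismantling_order V E r \<longleftrightarrow>
     well_order_on V r \<and> (\<forall>\<nu>\<in>V. \<not> largest V r \<nu> \<longrightarrow> (\<exists>\<mu>. dominates_above E r \<mu> \<nu>))"

definition dismantable :: "'a set \<Rightarrow> 'a rel \<Rightarrow> bool" where
  "dismantable V E \<longleftrightarrow> (\<exists>r. dismantling_order V E r)"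

definition natural_order :: "'a rel \<Rightarrow> bool" where
  "natural_order r \<longleftrightarrow> (\<exists>n. r =o natLeq_on n) \<or> r =o natLeq"

(* The value of \<delta> at a largest vertex is unconstrained. It never matters: a largest vertex is
   at least every \<nu>, so the iteration defining rho stops there at the latest. *)
definition domination_map :: "'a set \<Rightarrow> 'a rel \<Rightarrow> 'a rel \<Rightarrow> ('a \<Rightarrow> 'a) \<Rightarrow> bool" where
  "domination_map V E r \<delta> \<longleftrightarrow> (\<forall>\<nu>\<in>V. \<not> largest V r \<nu> \<longrightarrow> dominates_above E r (\<delta> \<nu>) \<nu>)"

definition rho_defined :: "'a set \<Rightarrow> 'a rel \<Rightarrow> ('a \<Rightarrow> 'a) \<Rightarrow> 'a \<Rightarrow> bool" where
  "rho_defined V r \<delta> \<nu> \<longleftrightarrow> (\<forall>\<mu>\<in>V. \<exists>k. (\<nu>, (\<delta> ^^ k) \<mu>) \<in> r)"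

definition rho :: "'a rel \<Rightarrow> ('a \<Rightarrow> 'a) \<Rightarrow> 'a \<Rightarrow> 'a \<Rightarrow> 'a" where
  "rho r \<delta> \<nu> \<mu> = (\<delta> ^^ (LEAST k. (\<nu>, (\<delta> ^^ k) \<mu>) \<in> r)) \<mu>"

definition cop_strategy :: "'a set \<Rightarrow> 'a rel \<Rightarrow> 'a \<Rightarrow> ('a \<Rightarrow> 'a \<Rightarrow> 'a) \<Rightarrow> bool" where
  "cop_strategy V E s S \<longleftrightarrow> s \<in> V \<and> (\<forall>c\<in>V. \<forall>r\<in>V. (c, S c r) \<in> E)"

(* p n is the vertex chosen in round n, by the cop for even n and by the robber for odd n.
   Plays are formally continued after a capture. This does not affect weakly_winning: a play
   that contains a capture satisfies its condition whatever happens afterwards, and a play that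
   ends with a capture can always be continued, since staying put is allowed. *)
definition cop_play :: "'a set \<Rightarrow> 'a rel \<Rightarrow> 'a \<Rightarrow> ('a \<Rightarrow> 'a \<Rightarrow> 'a) \<Rightarrow> (nat \<Rightarrow> 'a) \<Rightarrow> bool" where
  "cop_play V E s S p \<longleftrightarrow>
     p 0 = s \<and> p 1 \<in> V \<and>
     (\<forall>n. even n \<longrightarrow> p (n + 2) = S (p n) (p (n + 1))) \<and>
     (\<forall>n. odd n \<longrightarrow> (p n, p (n + 2)) \<in> E)"

(* Positions after round n. The robber has a position only for n \<ge> 1. *)
definition cop_pos :: "(nat \<Rightarrow> 'a) \<Rightarrow> nat \<Rightarrow> 'a" where
  "cop_pos p n = (if even n then p n else p (n - 1))"

definition robber_pos :: "(nat \<Rightarrow> 'a) \<Rightarrow> nat \<Rightarrow> 'a" where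
  "robber_pos p n = (if odd n then p n else p (n - 1))"

definition caught :: "(nat \<Rightarrow> 'a) \<Rightarrow> bool" where
  "caught p \<longleftrightarrow> (\<exists>n\<ge>1. cop_pos p n = robber_pos p n)"

definition weakly_winning :: "'a set \<Rightarrow> 'a rel \<Rightarrow> 'a \<Rightarrow> ('a \<Rightarrow> 'a \<Rightarrow> 'a) \<Rightarrow> bool" where
  "weakly_winning V E s S \<longleftrightarrow>
     (\<forall>p. cop_play V E s S p \<longrightarrow> caught p \<or> (\<forall>v\<in>V. finite {n. n \<ge> 1 \<and> robber_pos p n = v}))"

definition weakly_cop_win :: "'a set \<Rightarrow> 'a rel \<Rightarrow> bool" where
  "weakly_cop_win V E \<longleftrightarrow> (\<exists>s S. cop_strategy V E s S \<and> weakly_winning V E s S)"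

end

theory Submission
  imports Defs
begin

text \<open>
  Number the vertices along the order, so that a domination map strictly increases the number.
  Pushing the vertex of number \<open>j\<close> to its dominating vertex, successively for
  \<open>j = 0, 1, 2, \<dots>\<close>, yields the retractions \<open>\<rho>\<^sub>j\<close>. Since a dominating vertex inherits all later
  neighbours, these are graph homomorphisms, and more is true: if \<open>y\<close> is adjacent to \<open>x\<close>, then
  \<open>\<rho>\<^sub>j y\<close> is adjacent to \<open>\<rho>\<^sub>j\<^sub>+\<^sub>1 x\<close> (\<open>retract_Suc_edge\<close>). A cop who stands on the shadow
  \<open>\<rho>\<^sub>j\<^sub>+\<^sub>1\<close> of the robber can thus answer each robber move by stepping onto his shadow
  \<open>\<rho>\<^sub>j\<close>. As \<open>\<rho>\<^sub>0\<close> is the identity, this catches the robber after finitely many rounds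
  (\<open>caught_if_shadow\<close>).

  It remains to reach a shadow. As long as the cop is not adjacent to one, she climbs along the
  domination map. Suppose that the climb never ends, and let \<open>v\<close> be a vertex.
  Some \<open>\<rho>\<^sub>\<gamma>\<close> identifies \<open>v\<close> with the starting vertex of the cop. From the time when the cop has passed \<open>\<gamma>\<close>, her position is
  therefore a shadow of \<open>v\<close> (\<open>climb_is_shadow\<close>). If the robber were at \<open>v\<close> then, the cop would be
  on his shadow and the climb would end. Hence he visits \<open>v\<close> only finitely often.
\<close>

section \<open>Retractions along a domination map\<close>

text \<open>
  The order is represented by an injective rank function into the natural numbers. Gaps in its
  range are harmless, which gives finite orders and the order type of the natural numbers a
  common treatment.
\<close>

locale ranked_domination =
  fixes V :: "'a set" and E :: "'a rel" and h :: "'a \<Rightarrow> nat" and \<delta> :: "'a \<Rightarrow> 'a"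
  assumes graph: "refl_graph V E"
    and inj: "inj_on h V"
    and dom_in: "\<lbrakk>x \<in> V; \<gamma> \<in> V; h x < h \<gamma>\<rbrakk> \<Longrightarrow> \<delta> x \<in> V"
    and dom_less: "\<lbrakk>x \<in> V; \<gamma> \<in> V; h x < h \<gamma>\<rbrakk> \<Longrightarrow> h x < h (\<delta> x)"
    and dom_edge: "\<lbrakk>x \<in> V; \<gamma> \<in> V; h x < h \<gamma>; (x, y) \<in> E; h x \<le> h y\<rbrakk> \<Longrightarrow> (\<delta> x, y) \<in> E"
begin

lemma edge_in: "(x, y) \<in> E \<Longrightarrow> x \<in> V" "(x, y) \<in> E \<Longrightarrow> y \<in> V"
  using graph by (auto simp: refl_graph_def)

lemma edge_refl: "x \<in> V \<Longrightarrow> (x, x) \<in> E"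
  using graph by (auto simp: refl_graph_def refl_on_def)

lemma edge_sym: "(x, y) \<in> E \<Longrightarrow> (y, x) \<in> E"
  using graph by (auto simp: refl_graph_def dest: symD)

text \<open>
  This is \<open>\<rho>\<close> indexed by ranks and written as a recursion on the index, which turns every
  statement about \<open>\<rho>\<close> into an induction whose step handles a single vertex.
\<close>

primrec retract :: "nat \<Rightarrow> 'a \<Rightarrow> 'a" where
  "retract 0 x = x"
| "retract (Suc j) x = (if h (retract j x) = j then \<delta> (retract j x) else retract j x)"

text \<open>
  Beyond the rank of a largest vertex, \<open>retract\<close> would apply the domination map to that vertex,
  where its value is arbitrary.
\<close>

definition is_level :: "nat \<Rightarrow> bool" where
  "is_level j \<longleftrightarrow> (\<exists>\<gamma>\<in>V. j \<le> h \<gamma>)"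

lemma is_level_rank: "x \<in> V \<Longrightarrow> is_level (h x)"
  by (auto simp: is_level_def)

lemma is_level_SucD: "is_level (Suc j) \<Longrightarrow> is_level j"
  unfolding is_level_def using Suc_leD by blast

lemma retract_in_above:
  assumes "is_level j" and "x \<in> V"
  shows "retract j x \<in> V \<and> j \<le> h (retract j x)"
  using assms
proof (induction j)
  case 0
  then show ?case by simp
next
  case (Suc j)
  then obtain \<gamma> where \<gamma>: "\<gamma> \<in> V" "j < h \<gamma>"
    by (auto simp: is_level_def)
  from Suc is_level_SucD have IH: "retract j x \<in> V" "j \<le> h (retract j x)"
    by blast+
  then show ?case
    using dom_in[of "retract j x" \<gamma>] dom_less[of "retract j x" \<gamma>] \<gamma> by auto
qed

lemma retract_eq_self:
  assumes "j \<le> h x"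
  shows "retract j x = x"
  using assms by (induction j) auto

lemma retract_eq_mono:
  assumes "retract i x = retract i y" and "i \<le> j"
  shows "retract j x = retract j y"
  using assms(2,1) by (induction rule: dec_induct) auto

text \<open>
  A domination step is invisible to all later retractions, as they perform this step themselves.
\<close>

lemma retract_dom:
  assumes "x \<in> V" and "\<gamma> \<in> V" and "h x < h \<gamma>" and "h x < j"
  shows "retract j (\<delta> x) = retract j x"
proof (rule retract_eq_mono)
  show "retract (Suc (h x)) (\<delta> x) = retract (Suc (h x)) x"
    using dom_less[OF assms(1-3)] by (simp add: retract_eq_self)
qed (use assms in simp)

text \<open>
  If \<open>\<rho>\<^sub>j x\<close> is moved in step \<open>j\<close>, it is replaced by a vertex that dominates it
  among the vertices of rank at least \<open>j\<close>, and \<open>\<rho>\<^sub>j y\<close> is one of these.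
\<close>

lemma retract_half_step:
  assumes "is_level (Suc j)" and "(retract j x, retract j y) \<in> E" and "x \<in> V" and "y \<in> V"
  shows "(retract (Suc j) x, retract j y) \<in> E"
proof -
  obtain \<gamma> where "\<gamma> \<in> V" "j < h \<gamma>"
    using assms(1) by (auto simp: is_level_def)
  moreover have "retract j x \<in> V" "j \<le> h (retract j y)"
    using retract_in_above is_level_SucD assms by blast+
  ultimately show ?thesis
    using dom_edge[of "retract j x" \<gamma> "retract j y"] assms(2) by auto
qed

lemma retract_edge:
  assumes "is_level j" and "(x, y) \<in> E"
  shows "(retract j x, retract j y) \<in> E"
  using assms(1)
proof (induction j)
  case 0
  then show ?case using assms(2) by simp
next
  case (Suc j)
  obtain \<gamma> where \<gamma>: "\<gamma> \<in> V" "j < h \<gamma>"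
    using Suc.prems by (auto simp: is_level_def)
  have V: "x \<in> V" "y \<in> V"
    using assms(2) edge_in by auto
  have IH: "(retract j x, retract j y) \<in> E"
    using Suc is_level_SucD by blast
  have half: "(retract (Suc j) x, retract j y) \<in> E"
    using retract_half_step Suc.prems IH V by blast
  \<comment> \<open>The second endpoint is replaced in the same way. Its new neighbour has rank at least
    \<open>j + 1\<close>, so the domination of \<open>\<rho>\<^sub>j y\<close> still covers it.\<close>
  have "j \<le> h (retract (Suc j) x)"
    using retract_in_above[OF Suc.prems V(1)] by linarith
  moreover have "retract j y \<in> V"
    using half edge_in by blast
  ultimately show ?case
    using dom_edge[of "retract j y" \<gamma> "retract (Suc j) x"] half edge_sym \<gamma>
    by (metis retract.simps(2))
qed

lemma retract_Suc_edge:
  assumes "is_level (Suc j)" and "(x, y) \<in> E"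
  shows "(retract (Suc j) x, retract j y) \<in> E"
  using assms retract_half_step retract_edge is_level_SucD edge_in by blast

text \<open>
  This is the link to the definition of \<open>\<rho>\<close> by iterating \<open>\<delta>\<close> a minimal number of times: no
  shorter iteration reaches rank \<open>j\<close>.
\<close>

lemma retract_eq_funpow:
  assumes "is_level j" and "x \<in> V"
  shows "\<exists>k. retract j x = (\<delta> ^^ k) x \<and> (\<forall>i<k. (\<delta> ^^ i) x \<in> V \<and> h ((\<delta> ^^ i) x) < j)"
  using assms
proof (induction j)
  case 0
  show ?case by (rule exI[of _ 0]) simp
next
  case (Suc j)
  then obtain k where k: "retract j x = (\<delta> ^^ k) x"
    "\<forall>i<k. (\<delta> ^^ i) x \<in> V \<and> h ((\<delta> ^^ i) x) < j"
    using is_level_SucD by blast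
  have V: "retract j x \<in> V"
    using retract_in_above Suc.prems is_level_SucD by blast
  show ?case
  proof (cases "h (retract j x) = j")
    case True
    then show ?thesis
      using k V by (intro exI[of _ "Suc k"]) (auto simp: less_Suc_eq)
  next
    case False
    then show ?thesis
      using k by (intro exI[of _ k]) auto
  qed
qed

section \<open>The strategy\<close>

definition near_shadow :: "'a \<Rightarrow> 'a \<Rightarrow> nat \<Rightarrow> bool" where
  "near_shadow c y j \<longleftrightarrow> is_level j \<and> (c, retract j y) \<in> E"

text \<open>
  Choosing the least index makes the strategy independent of the past: the cop need not remember
  which shadow she is following in order to reach shadows of ever smaller index.
\<close>

definition chase :: "'a \<Rightarrow> 'a \<Rightarrow> 'a" where
  "chase c y =
     (if \<exists>j. near_shadow c y j then retract (LEAST j. near_shadow c y j) y else \<delta> c)"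

text \<open>
  A cop on a largest vertex \<open>c\<close> stands on a shadow already, because the retraction of index \<open>h c\<close>
  is constant. Hence she never needs the domination map there.
\<close>

lemma higher_vertex_if_no_shadow:
  assumes "c \<in> V" and "y \<in> V" and "\<nexists>j. near_shadow c y j"
  shows "\<exists>\<gamma>\<in>V. h c < h \<gamma>"
proof (rule ccontr)
  assume "\<not> ?thesis"
  moreover have "retract (h c) y \<in> V" "h c \<le> h (retract (h c) y)"
    using retract_in_above is_level_rank assms by blast+
  ultimately have "retract (h c) y = c"
    using inj assms(1) by (metis inj_onD le_neq_implies_less)
  then have "near_shadow c y (h c)"
    using assms(1) by (simp add: near_shadow_def is_level_rank edge_refl)
  with assms(3) show False by blast
qed

lemma chase_edge:
  assumes "c \<in> V" and "y \<in> V"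
  shows "(c, chase c y) \<in> E"
proof (cases "\<exists>j. near_shadow c y j")
  case True
  then obtain m where "near_shadow c y m" "chase c y = retract m y"
    unfolding chase_def by (metis LeastI_ex)
  then show ?thesis
    by (simp add: near_shadow_def)
next
  case False
  then obtain \<gamma> where "\<gamma> \<in> V" "h c < h \<gamma>"
    using higher_vertex_if_no_shadow assms by blast
  then have "(\<delta> c, c) \<in> E"
    using dom_edge edge_refl assms(1) by blast
  then show ?thesis
    using False edge_sym by (simp add: chase_def)
qed

lemma chase_strategy: "s \<in> V \<Longrightarrow> cop_strategy V E s chase"
  by (auto simp: cop_strategy_def chase_edge)

context
  fixes s :: 'a and p :: "nat \<Rightarrow> 'a"
  assumes start: "s \<in> V" and play: "cop_play V E s chase p"
begin

abbreviation "cop k \<equiv> p (2 * k)"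
abbreviation "robber k \<equiv> p (Suc (2 * k))"

lemma cop_Suc: "cop (Suc k) = chase (cop k) (robber k)"
proof -
  have "p (2 * k + 2) = chase (p (2 * k)) (p (2 * k + 1))"
    using play unfolding cop_play_def by (meson dvd_triv_left)
  then show ?thesis by simp
qed

lemma robber_Suc: "(robber k, robber (Suc k)) \<in> E"
proof -
  have "odd (Suc (2 * k))" by simp
  then have "(p (Suc (2 * k)), p (Suc (2 * k) + 2)) \<in> E"
    using play unfolding cop_play_def by blast
  then show ?thesis by simp
qed

lemma robber_in: "robber k \<in> V"
  using robber_Suc edge_in by blast

lemma cop_in: "cop k \<in> V"
proof (induction k)
  case 0
  then show ?case using start play by (simp add: cop_play_def)
next
  case (Suc k)
  then show ?case
    unfolding cop_Suc using chase_edge robber_in edge_in by blast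
qed

lemma caught_if_cop_on_robber:
  assumes "cop (Suc k) = robber k"
  shows "caught p"
  unfolding caught_def
  by (rule exI[of _ "2 * Suc k"]) (use assms in \<open>simp add: cop_pos_def robber_pos_def\<close>)

text \<open>
  The index of the shadow on which the cop stands drops in every round, and the shadow of index
  0 is the robber himself.
\<close>

lemma caught_if_shadow:
  assumes "near_shadow (cop k) (robber k) j"
  shows "caught p"
  using assms
proof (induction j arbitrary: k rule: less_induct)
  case (less j)
  define m where "m = (LEAST i. near_shadow (cop k) (robber k) i)"
  have m: "near_shadow (cop k) (robber k) m" "m \<le> j"
    unfolding m_def using less.prems by (auto intro: LeastI Least_le)
  have step: "cop (Suc k) = retract m (robber k)"
    unfolding cop_Suc chase_def m_def using less.prems by auto
  show ?case
  proof (cases m)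
    case 0
    then show ?thesis
      using step caught_if_cop_on_robber by simp
  next
    case (Suc i)
    then have "near_shadow (cop (Suc k)) (robber (Suc k)) i"
      unfolding step using m(1) retract_Suc_edge[OF _ robber_Suc] is_level_SucD
      by (auto simp: near_shadow_def simp del: retract.simps)
    then show ?thesis
      using less.IH Suc m(2) by (meson Suc_le_eq)
  qed
qed

context
  assumes free: "\<not> caught p"
begin

lemma cop_climbs: "cop (Suc k) = \<delta> (cop k)"
  unfolding cop_Suc chase_def using caught_if_shadow free by auto

lemma cop_has_higher: "\<exists>\<gamma>\<in>V. h (cop k) < h \<gamma>"
  using higher_vertex_if_no_shadow cop_in robber_in caught_if_shadow free by blast

lemma cop_rank_Suc: "h (cop k) < h (cop (Suc k))"
  using cop_has_higher dom_less cop_in unfolding cop_climbs by blast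

lemma le_cop_rank: "k \<le> h (cop k)"
proof (induction k)
  case (Suc k)
  then show ?case using cop_rank_Suc[of k] by linarith
qed simp

lemma retract_start: "h (cop k) \<le> j \<Longrightarrow> retract j s = retract j (cop k)"
proof (induction k)
  case 0
  then show ?case using play by (simp add: cop_play_def)
next
  case (Suc k)
  then have less: "h (cop k) < j"
    using cop_rank_Suc[of k] by linarith
  have "retract j (\<delta> (cop k)) = retract j (cop k)"
    using retract_dom cop_in less cop_has_higher by blast
  then show ?case
    unfolding cop_climbs using Suc.IH less by simp
qed

lemma climb_is_shadow:
  assumes "retract i s = retract i v" and "i \<le> h (cop k)"
  shows "retract (h (cop k)) v = cop k"
proof -
  have "retract (h (cop k)) v = retract (h (cop k)) s"
    using retract_eq_mono assms by metis
  also have "\<dots> = retract (h (cop k)) (cop k)"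
    using retract_start by blast
  finally show ?thesis by (simp add: retract_eq_self)
qed

lemma robber_avoids:
  assumes "retract i s = retract i v" and "i \<le> k"
  shows "robber k \<noteq> v"
proof
  assume "robber k = v"
  moreover have "retract (h (cop k)) v = cop k"
    using climb_is_shadow assms le_cop_rank le_trans by blast
  ultimately have "near_shadow (cop k) (robber k) (h (cop k))"
    using cop_in by (simp add: near_shadow_def is_level_rank edge_refl)
  then show False using caught_if_shadow free by blast
qed

lemma finite_robber_visits:
  assumes "retract i s = retract i v"
  shows "finite {n. n \<ge> 1 \<and> robber_pos p n = v}"
proof (rule finite_subset)
  show "{n. n \<ge> 1 \<and> robber_pos p n = v} \<subseteq> {..2 * i + 1}"
  proof (rule subsetI, rule ccontr)
    fix n assume "n \<in> {n. n \<ge> 1 \<and> robber_pos p n = v}" and "n \<notin> {..2 * i + 1}"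
    then have n: "n \<ge> 1" "robber_pos p n = v" "n > 2 * i + 1"
      by simp_all
    from n(1) have "\<exists>k. n = Suc (2 * k) \<or> n = Suc (Suc (2 * k))"
      by presburger
    then obtain k where k: "n = Suc (2 * k) \<or> n = Suc (Suc (2 * k))"
      by blast
    then have "robber k = v"
      using n(2) by (auto simp: robber_pos_def)
    moreover have "i \<le> k"
      using k n(3) by linarith
    ultimately show False
      using robber_avoids[OF assms] by blast
  qed
qed simp

end

end

theorem weakly_cop_win_if_retracts_merge:
  assumes "\<forall>x\<in>V. \<forall>y\<in>V. \<exists>i. retract i x = retract i y"
  shows "weakly_cop_win V E"
proof -
  obtain s where s: "s \<in> V"
    using graph by (auto simp: refl_graph_def)
  have "weakly_winning V E s chase"
    unfolding weakly_winning_def using finite_robber_visits[OF s] assms s by blast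
  then show ?thesis
    using chase_strategy[OF s] by (auto simp: weakly_cop_win_def)
qed

end

section \<open>Natural dismantling orders\<close>

lemma natural_order_rank:
  assumes "natural_order r"
  shows "\<exists>h :: 'a \<Rightarrow> nat. inj_on h (Field r) \<and>
           (\<forall>x\<in>Field r. \<forall>y\<in>Field r. (x, y) \<in> r \<longleftrightarrow> h x \<le> h y)"
proof -
  have "\<exists>h. iso r natLeq h \<or> (\<exists>n. iso r (natLeq_on n) h)"
    using assms by (auto simp: natural_order_def ordIso_def)
  then obtain h where "iso r natLeq h \<or> (\<exists>n. iso r (natLeq_on n) h)" by blast
  then show ?thesis
  proof (elim disjE exE)
    assume "iso r natLeq h"
    then show ?thesis
      by (intro exI[of _ h]) (auto simp: iso_iff2 bij_betw_def natLeq_def)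
  next
    fix n assume i: "iso r (natLeq_on n) h"
    then have "h ` Field r = {x. x < n}"
      unfolding iso_iff2 bij_betw_def Field_natLeq_on by blast
    with i show ?thesis
      by (intro exI[of _ h]) (auto simp: iso_iff2 bij_betw_def)
  qed
qed

theorem theorem15:
  fixes V :: "'a set" and E :: "'a rel" and r :: "'a rel" and \<delta> :: "'a \<Rightarrow> 'a"
  assumes "refl_graph V E"
    and "dismantable V E"
    and "dismantling_order V E r"
    and "natural_order r"
    and "domination_map V E r \<delta>"
    and "\<forall>\<nu>\<in>V. rho_defined V r \<delta> \<nu>"
    and "\<forall>\<nu>\<in>V. \<forall>\<mu>\<in>V. \<exists>\<gamma>\<in>V. rho r \<delta> \<gamma> \<nu> = rho r \<delta> \<gamma> \<mu>"
  shows "weakly_cop_win V E"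
proof -
  have wo: "well_order_on V r"
    using assms(3) by (simp add: dismantling_order_def)
  then have Field: "Field r = V"
    using well_order_on_Field by blast
  obtain h :: "'a \<Rightarrow> nat" where h: "inj_on h V"
    and le: "\<And>x y. x \<in> V \<Longrightarrow> y \<in> V \<Longrightarrow> (x, y) \<in> r \<longleftrightarrow> h x \<le> h y"
    using natural_order_rank[OF assms(4)] unfolding Field by blast
  have above: "above r x = {y \<in> V. h x \<le> h y}" if "x \<in> V" for x
    using le that Field by (auto simp: above_def Field_def)
  have dom: "dominates_above E r (\<delta> x) x" if "x \<in> V" "\<gamma> \<in> V" "h x < h \<gamma>" for x \<gamma>
  proof -
    have "\<not> largest V r x"
      using that le[OF that(2,1)] by (auto simp: largest_def)
    then show ?thesis
      using assms(5) that(1) by (simp add: domination_map_def)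
  qed
  have E: "E \<subseteq> V \<times> V"
    using assms(1) by (simp add: refl_graph_def)
  interpret ranked_domination V E h \<delta>
  proof
    show "refl_graph V E" "inj_on h V" by fact+
  next
    fix x \<gamma> assume x: "x \<in> V" "\<gamma> \<in> V" "h x < h \<gamma>"
    have d: "\<delta> x \<in> V" "h x \<le> h (\<delta> x)" "\<delta> x \<noteq> x"
      using dom[OF x] x(1) unfolding dominates_above_def dominates_def above[OF x(1)] by auto
    then have "h (\<delta> x) \<noteq> h x"
      using inj_onD[OF h, of "\<delta> x" x] x(1) by blast
    with d show "\<delta> x \<in> V" "h x < h (\<delta> x)"
      by simp_all
    show "(\<delta> x, y) \<in> E" if "(x, y) \<in> E" "h x \<le> h y" for y
      using dom[OF x] x(1) E that unfolding dominates_above_def dominates_def above[OF x(1)]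
      by auto
  qed
  have rho: "rho r \<delta> \<gamma> x = retract (h \<gamma>) x" if \<gamma>: "\<gamma> \<in> V" and x: "x \<in> V" for \<gamma> x
  proof -
    obtain k where k: "retract (h \<gamma>) x = (\<delta> ^^ k) x"
      "\<And>i. i < k \<Longrightarrow> (\<delta> ^^ i) x \<in> V \<and> h ((\<delta> ^^ i) x) < h \<gamma>"
      using retract_eq_funpow[OF is_level_rank[OF \<gamma>] x] by blast
    \<comment> \<open>Before the iteration reaches \<open>\<gamma>\<close> it stays inside \<open>V\<close>, where comparing in \<open>r\<close> and
      comparing ranks are the same. Outside \<open>V\<close> the rank function is arbitrary.\<close>
    have "(LEAST i. (\<gamma>, (\<delta> ^^ i) x) \<in> r) = k"
    proof (rule Least_equality)
      show "(\<gamma>, (\<delta> ^^ k) x) \<in> r"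
        using retract_in_above[OF is_level_rank[OF \<gamma>] x] le[OF \<gamma>] k(1) by simp
    next
      fix i assume "(\<gamma>, (\<delta> ^^ i) x) \<in> r"
      then have "\<not> i < k"
        using k(2)[of i] le[OF \<gamma>] by auto
      then show "k \<le> i" by simp
    qed
    then show ?thesis using k(1) by (simp add: rho_def)
  qed
  show ?thesis
    using weakly_cop_win_if_retracts_merge assms(7) rho by metis
qed

end
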